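(* The Dual-minus sharp order $\overset{{\rm DM}\text{-}\#}{\leq}$ is a partial order (reflexive, antisymmetric and transitive) on $\mathbb{D}_n^{\rm CM}$.
   Context: $\varepsilon$ is the dual unit: $\varepsilon\neq 0$, $\varepsilon^2=0$, commuting with reals. $\mathbb{D}^{m\times n}$ is the set of $m\times n$ dual matrices $\widehat E=E+\varepsilon E_0$ with $E,E_0\in\mathbb{R}^{m\times n}$, with the obvious addition, multiplication and transpose $\widehat E^{T}=E^T+\varepsilon E_0^T$. The dual Moore-Penrose generalized inverse (DMPGI) of $\widehat E\in\mathbb{D}^{m\times n}$ is the unique $\widehat X\in\mathbb{D}^{n\times m}$, if it exists, with $\widehat E\widehat X\widehat E=\widehat E$, $\widehat X\widehat E\widehat X=\widehat X$, $(\widehat E\widehat X)^T=\widehat E\widehat X$, $(\widehat X\widehat E)^T=\widehat X\widehat E$. The dual group generalized inverse (DGGI) of $\widehat E\in\mathbb{D}^{n\times n}$ is the $\widehat X\in\mathbb{D}^{n\times n}$, if it exists, with $\widehat E\widehat X\widehat E=\widehat E$, $\widehat X\widehat E\widehat X=\widehat X$, $\widehat E\widehat X=\widehat X\widehat E$. $\mathbb{D}_n^{\rm CM}$ is the set of dual matrices in $\mathbb{D}^{n\times n}$ of dual index one, i.e. (equivalently) those whose DGGI exists; for $\widehat E=E+\varepsilon E_0\in\mathbb{D}_n^{\rm CM}$ the DMPGI of $\widehat E$ exists and $\mathrm{rk}(E^2)=\mathrm{rk}(E)$. Sharp partial order: for real $n\times n$ matrices $E,F$ with $\mathrm{rk}(E^2)=\mathrm{rk}(E)$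 and $\mathrm{rk}(F^2)=\mathrm{rk}(F)$, $E\overset{\#}{\leq}F$ means $EF=E^2=FE$. Dual-minus sharp order: for $\widehat E=E+\varepsilon E_0,\widehat F=F+\varepsilon F_0\in\mathbb{D}_n^{\rm CM}$, $\widehat E\overset{{\rm DM}\text{-}\#}{\leq}\widehat F$ means that $E\overset{\#}{\leq}F$ and the DMPGI of $\widehat F-\widehat E$ exists. *)

theory Defs
  imports "HOL-Analysis.Analysis"
begin

section \<open>Dual numbers\<close>

text \<open>\<open>Dual a b\<close> stands for \<open>a + \<epsilon> b\<close>, where \<open>\<epsilon> \<noteq> 0\<close> and \<open>\<epsilon>\<^sup>2 = 0\<close>.\<close>

datatype dual_num = Dual (std: real) (inf_part: real)

lemma dual_num_eq_iff: "x = y \<longleftrightarrow> std x = std y \<and> inf_part x = inf_part y"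
  by (cases x; cases y) simp

instantiation dual_num :: comm_ring_1
begin

definition "0 = Dual 0 0"
definition "1 = Dual 1 0"
definition "x + y = Dual (std x + std y) (inf_part x + inf_part y)"
definition "- x = Dual (- std x) (- inf_part x)"
definition "x - y = Dual (std x - std y) (inf_part x - inf_part y)"
definition "x * y = Dual (std x * std y) (std x * inf_part y + inf_part x * std y)"

instance
  by standard
    (simp_all add: zero_dual_num_def one_dual_num_def plus_dual_num_def uminus_dual_num_def
      minus_dual_num_def times_dual_num_def algebra_simps)

end

lemma std_simps [simp]:
  "std 0 = 0" "std 1 = 1" "std (x + y) = std x + std y" "std (- x) = - std x"
  "std (x - y) = std x - std y" "std (x * y) = std x * std y"
  by (simp_all add: zero_dual_num_def one_dual_num_def plus_dual_num_def uminus_dual_num_def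
      minus_dual_num_def times_dual_num_def)

lemma inf_part_simps [simp]:
  "inf_part 0 = 0" "inf_part 1 = 0" "inf_part (x + y) = inf_part x + inf_part y"
  "inf_part (- x) = - inf_part x" "inf_part (x - y) = inf_part x - inf_part y"
  "inf_part (x * y) = std x * inf_part y + inf_part x * std y"
  by (simp_all add: zero_dual_num_def one_dual_num_def plus_dual_num_def uminus_dual_num_def
      minus_dual_num_def times_dual_num_def)

definition dual_eps :: dual_num
  where "dual_eps = Dual 0 1"

lemma dual_eps_nonzero: "dual_eps \<noteq> 0"
  and dual_eps_square: "dual_eps * dual_eps = 0"
  and dual_num_decomp: "x = Dual (std x) 0 + dual_eps * Dual (inf_part x) 0"
  by (simp_all add: dual_eps_def dual_num_eq_iff)


section \<open>Dual matrices\<close>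

text \<open>
  Dual \<open>m \<times> n\<close> matrices are the library's matrices over the commutative ring of dual numbers, with
  the library's sum, product \<open>**\<close> and \<open>transpose\<close>. The lemmas below confirm that the operations are
  the expected ones on \<open>E + \<epsilon> E0\<close>, where \<open>E\<close> is \<open>std_mat\<close> and \<open>E0\<close> is \<open>inf_mat\<close>.
\<close>

definition std_mat :: "dual_num^'n^'m \<Rightarrow> real^'n^'m"
  where "std_mat = map_matrix std"

definition inf_mat :: "dual_num^'n^'m \<Rightarrow> real^'n^'m"
  where "inf_mat = map_matrix inf_part"

lemma dual_mat_eq_iff: "A = B \<longleftrightarrow> std_mat A = std_mat B \<and> inf_mat A = inf_mat B"
  by (auto simp: std_mat_def inf_mat_def vec_eq_iff dual_num_eq_iff)

lemma std_sum: "std (sum f S) = (\<Sum>x\<in>S. std (f x))"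
  by (induction S rule: infinite_finite_induct) simp_all

lemma inf_part_sum: "inf_part (sum f S) = (\<Sum>x\<in>S. inf_part (f x))"
  by (induction S rule: infinite_finite_induct) simp_all

lemma std_mat_simps:
  "std_mat 0 = 0" "std_mat (A + B) = std_mat A + std_mat B" "std_mat (A - B) = std_mat A - std_mat B"
  "std_mat (transpose A) = transpose (std_mat A)"
  by (simp_all add: std_mat_def transpose_def vec_eq_iff)

lemma inf_mat_simps:
  "inf_mat 0 = 0" "inf_mat (A + B) = inf_mat A + inf_mat B" "inf_mat (A - B) = inf_mat A - inf_mat B"
  "inf_mat (transpose A) = transpose (inf_mat A)"
  by (simp_all add: inf_mat_def transpose_def vec_eq_iff)

lemma std_mat_mult: "std_mat (A ** B) = std_mat A ** std_mat B"
  by (simp add: std_mat_def matrix_matrix_mult_def vec_eq_iff std_sum)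

lemma inf_mat_mult: "inf_mat (A ** B) = std_mat A ** inf_mat B + inf_mat A ** std_mat B"
  by (simp add: std_mat_def inf_mat_def matrix_matrix_mult_def vec_eq_iff inf_part_sum sum.distrib)


section \<open>Dual generalized inverses\<close>

definition is_DMPGI :: "dual_num^'n^'m \<Rightarrow> dual_num^'m^'n \<Rightarrow> bool"
  where "is_DMPGI E X \<longleftrightarrow>
    E ** X ** E = E \<and> X ** E ** X = X \<and>
    transpose (E ** X) = E ** X \<and> transpose (X ** E) = X ** E"

lemma is_DMPGI_unique:
  assumes X: "is_DMPGI E X" and Y: "is_DMPGI E Y"
  shows "X = Y"
proof -
  have tX: "transpose (E ** X) = E ** X" "transpose (X ** E) = X ** E"
    and tY: "transpose (E ** Y) = E ** Y" "transpose (Y ** E) = Y ** E"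
    and eX: "E ** X ** E = E" "X ** E ** X = X" and eY: "E ** Y ** E = E" "Y ** E ** Y = Y"
    using X Y by (auto simp: is_DMPGI_def)
  have "E ** X = transpose ((E ** Y) ** (E ** X))"
    by (metis eY(1) matrix_mul_assoc tX(1))
  also have "\<dots> = (E ** X) ** (E ** Y)"
    by (metis matrix_transpose_mul tX(1) tY(1))
  also have "\<dots> = E ** Y"
    by (metis eX(1) matrix_mul_assoc)
  finally have 1: "E ** X = E ** Y" .
  have "X ** E = transpose ((X ** E) ** (Y ** E))"
    by (metis eY(1) matrix_mul_assoc tX(2))
  also have "\<dots> = (Y ** E) ** (X ** E)"
    by (metis matrix_transpose_mul tX(2) tY(2))
  also have "\<dots> = Y ** E"
    by (metis eX(1) matrix_mul_assoc)
  finally have 2: "X ** E = Y ** E" .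
  show ?thesis
    by (metis 1 2 eX(2) eY(2) matrix_mul_assoc)
qed

definition has_DMPGI :: "dual_num^'n^'m \<Rightarrow> bool"
  where "has_DMPGI E \<longleftrightarrow> (\<exists>X. is_DMPGI E X)"

definition is_DGGI :: "dual_num^'n^'n \<Rightarrow> dual_num^'n^'n \<Rightarrow> bool"
  where "is_DGGI E X \<longleftrightarrow> E ** X ** E = E \<and> X ** E ** X = X \<and> E ** X = X ** E"

text \<open>
  \<open>dual_CM\<close> is the set of dual matrices of dual index one. We use the equivalent condition that the
  dual group generalized inverse exists.
\<close>

definition dual_CM :: "(dual_num^'n^'n) set"
  where "dual_CM = {E. \<exists>X. is_DGGI E X}"


section \<open>The orders\<close>

definition sharp_le :: "real^'n^'n \<Rightarrow> real^'n^'n \<Rightarrow> bool"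
  where "sharp_le E F \<longleftrightarrow>
    rank (E ** E) = rank E \<and> rank (F ** F) = rank F \<and> E ** F = E ** E \<and> E ** E = F ** E"

definition DM_sharp_le :: "dual_num^'n^'n \<Rightarrow> dual_num^'n^'n \<Rightarrow> bool"
  where "DM_sharp_le E F \<longleftrightarrow> sharp_le (std_mat E) (std_mat F) \<and> has_DMPGI (F - E)"

definition DM_sharp_order :: "((dual_num^'n^'n) \<times> (dual_num^'n^'n)) set"
  where "DM_sharp_order = {(E, F). E \<in> dual_CM \<and> F \<in> dual_CM \<and> DM_sharp_le E F}"

end

theory Submission
  imports Defs
begin

text \<open>
  A dual matrix \<open>C + \<epsilon> C0\<close> has a DMPGI iff it has an inner inverse iff \<open>C0 = C P + Q C\<close> for some
  real \<open>P, Q\<close>. If \<open>E \<le> F \<le> G\<close> in the sharp order, with group inverses \<open>X, Y, Z\<close> and idempotents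
  \<open>e = E X\<close>, \<open>f = F Y\<close>, \<open>g = G Z\<close>, then for \<open>C = G - E\<close> we have \<open>F - E = C (f - e) = (f - e) C\<close> and
  \<open>G - F = C (g - f) = (g - f) C\<close>. Hence the infinitesimal part of the dual difference is again of
  the form \<open>C P + Q C\<close>, which gives transitivity. For antisymmetry, the standard parts agree, and a
  purely infinitesimal matrix with an inner inverse vanishes.
\<close>

section \<open>Ring laws for matrix products and transposes\<close>

lemma matrix_diff_ldistrib: "A ** (B - C) = A ** B - A ** (C :: 'a::ring_1^'n^'m)"
  by (vector matrix_matrix_mult_def right_diff_distrib sum_subtractf)

lemma matrix_diff_rdistrib: "(A - B) ** C = A ** C - B ** (C :: 'a::ring_1^'n^'m)"
  by (vector matrix_matrix_mult_def left_diff_distrib sum_subtractf)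

lemma matrix_add_rdistrib: "(A + B) ** C = A ** C + B ** (C :: 'a::ring_1^'n^'m)"
  by (vector matrix_matrix_mult_def distrib_right sum.distrib)

lemma matrix_minus_right: "A ** (- B) = - (A ** (B :: 'a::ring_1^'n^'m))"
  by (vector matrix_matrix_mult_def sum_negf)

lemma matrix_minus_left: "(- A) ** B = - (A ** (B :: 'a::ring_1^'n^'m))"
  by (vector matrix_matrix_mult_def sum_negf)

lemmas matrix_distribs =
  matrix_add_ldistrib matrix_add_rdistrib matrix_diff_ldistrib matrix_diff_rdistrib
  matrix_minus_right matrix_minus_left

lemma transpose_add: "transpose (A + B) = transpose A + transpose B"
  by (simp add: transpose_def vec_eq_iff)

lemma transpose_diff: "transpose (A - B) = transpose A - transpose B"
  by (simp add: transpose_def vec_eq_iff)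


section \<open>Inverses of dual matrices\<close>

definition dual_mat :: "real^'n^'m \<Rightarrow> real^'n^'m \<Rightarrow> dual_num^'n^'m"
  where "dual_mat A B = (\<chi> i j. Dual (A $ i $ j) (B $ i $ j))"

lemma dual_mat_simps [simp]: "std_mat (dual_mat A B) = A" "inf_mat (dual_mat A B) = B"
  by (simp_all add: dual_mat_def std_mat_def inf_mat_def vec_eq_iff)

lemma mat_1_parts [simp]: "std_mat (mat 1) = mat 1" "inf_mat (mat 1) = 0"
  by (simp_all add: std_mat_def inf_mat_def mat_def vec_eq_iff)

text \<open>Pairing a kernel vector \<open>x\<close> with its image gives \<open>0\<close> as the
  sum of the squared lengths of \<open>x\<close> and \<open>transpose K *v x\<close>, so the kernel
  is trivial.\<close>

lemma invertible_one_plus_gram: "invertible (mat 1 + K ** transpose (K :: real^'m^'n))"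
proof -
  have "x = 0" if "(mat 1 + K ** transpose K) *v x = 0" for x
  proof -
    have "0 = x \<bullet> ((mat 1 + K ** transpose K) *v x)"
      using that by simp
    also have "\<dots> = x \<bullet> x + x \<bullet> (K *v (transpose K *v x))"
      by (simp only: matrix_vector_mult_add_rdistrib matrix_vector_mul_lid matrix_vector_mul_assoc
          inner_add_right)
    also have "x \<bullet> (K *v (transpose K *v x)) = (transpose K *v x) \<bullet> (transpose K *v x)"
      by (simp only: dot_lmul_matrix[symmetric] transpose_matrix_vector)
    finally have "x \<bullet> x \<le> 0"
      using inner_ge_zero[of "transpose K *v x"] by linarith
    then show "x = 0"
      by (metis inner_gt_zero_iff not_le)
  qed
  then show ?thesis
    unfolding invertible_def using matrix_left_invertible_ker matrix_left_right_inverse by blast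
qed

lemma dual_invertible:
  assumes "invertible (std_mat Z)"
  shows "invertible (Z :: dual_num^'n^'n)"
proof -
  obtain W where W: "std_mat Z ** W = mat 1" "W ** std_mat Z = mat 1"
    using assms by (auto simp: invertible_def)
  \<comment> \<open>The expansion of \<open>1 / (A + \<epsilon> B)\<close> to first order, exact
    because \<open>\<epsilon>\<close> squares to zero.\<close>
  define V where "V = dual_mat W (- (W ** inf_mat Z ** W))"
  have "std_mat Z ** (W ** inf_mat Z ** W) = inf_mat Z ** W"
    by (metis W(1) matrix_mul_assoc matrix_mul_lid)
  moreover have "W ** inf_mat Z ** W ** std_mat Z = W ** inf_mat Z"
    by (metis W(2) matrix_mul_assoc matrix_mul_rid)
  ultimately have "Z ** V = mat 1" "V ** Z = mat 1"
    by (simp_all add: dual_mat_eq_iff std_mat_mult inf_mat_mult V_def W matrix_distribs)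
  then show ?thesis
    unfolding invertible_def by blast
qed


section \<open>Inner inverses and the DMPGI\<close>

text \<open>Kaplansky's formula: the projection onto the range of an idempotent \<open>e\<close> is
  \<open>e e\<^sup>T (1 + (e - e\<^sup>T)(e - e\<^sup>T)\<^sup>T)\<inverse>\<close>.\<close>

lemma idempotent_range_projection:
  fixes e :: "dual_num^'n^'n"
  assumes e: "e ** e = e"
  obtains p where "transpose p = p" "p ** e = e" "e ** p = p"
proof -
  define t where "t = transpose e"
  define D where "D = e - t"
  define z where "z = mat 1 + D ** transpose D"
  have t: "t ** t = t"
    unfolding t_def by (metis e matrix_transpose_mul)
  have tr: "transpose e = t" "transpose t = e"
    by (simp_all add: t_def)
  have "invertible (std_mat z)"
    using invertible_one_plus_gram[of "std_mat D"] by (simp add: z_def std_mat_simps std_mat_mult)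
  then obtain W where W: "z ** W = mat 1" "W ** z = mat 1"
    using dual_invertible by (auto simp: invertible_def)
  have z: "z = mat 1 + (e ** t - e - t + t ** e)"
    by (simp add: z_def D_def transpose_diff tr matrix_distribs e t)
  \<comment> \<open>\<open>z\<close> gives the same product with \<open>e\<close> from either side,
    and likewise with \<open>t\<close>; hence its inverse \<open>W\<close> commutes with
    both.\<close>
  have ez: "e ** z = e ** t ** e" "z ** e = e ** t ** e"
    by (simp_all add: z matrix_distribs e t matrix_mul_assoc)
       (simp_all add: e t flip: matrix_mul_assoc)
  have tz: "t ** z = t ** e ** t" "z ** t = t ** e ** t"
    by (simp_all add: z matrix_distribs e t matrix_mul_assoc)
       (simp_all add: e t flip: matrix_mul_assoc)
  have commute: "W ** A = A ** W" if "A ** z = z ** A" for A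
    by (metis W matrix_mul_assoc matrix_mul_lid matrix_mul_rid that)
  have eW: "W ** e = e ** W" and tW: "W ** t = t ** W"
    using commute ez tz by auto
  have "transpose z = z"
    by (simp add: z_def transpose_add matrix_transpose_mul)
  then have "transpose W ** z = mat 1"
    by (metis W(1) matrix_transpose_mul transpose_mat)
  then have tW': "transpose W = W"
    by (metis W(1) matrix_mul_assoc matrix_mul_lid matrix_mul_rid)
  show thesis
  proof
    show "transpose (e ** t ** W) = e ** t ** W"
      by (metis eW tW tW' tr matrix_mul_assoc matrix_transpose_mul)
    \<comment> \<open>Moving \<open>W\<close> past \<open>e\<close> turns the left side into
      \<open>e ** t ** e ** W = e ** z ** W\<close>.\<close>
    show "(e ** t ** W) ** e = e"
      by (metis W(1) eW ez(1) matrix_mul_assoc matrix_mul_rid)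
    show "e ** (e ** t ** W) = e ** t ** W"
      by (simp add: e matrix_mul_assoc)
  qed
qed

text \<open>The idempotent \<open>M ** X\<close> has the range of \<open>M\<close>. With
  \<open>p\<close> the symmetric projection onto that range, \<open>X ** p\<close> works, since
  \<open>M ** X ** p = p\<close>.\<close>

lemma symmetric_inner_inverse:
  fixes M :: "dual_num^'n^'m"
  assumes M: "M ** X ** M = M"
  obtains Y where "M ** Y ** M = M" "transpose (M ** Y) = M ** Y"
proof -
  have "(M ** X) ** (M ** X) = M ** X"
    by (simp add: M matrix_mul_assoc)
  then obtain p where p: "transpose p = p" "p ** (M ** X) = M ** X" "(M ** X) ** p = p"
    using idempotent_range_projection by blast
  show thesis
  proof
    show "M ** (X ** p) ** M = M"
      by (metis M p(2,3) matrix_mul_assoc)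
    show "transpose (M ** (X ** p)) = M ** (X ** p)"
      by (metis p(1,3) matrix_mul_assoc)
  qed
qed

lemma has_DMPGI_if_inner_inverse:
  fixes M :: "dual_num^'n^'m"
  assumes M: "M ** X ** M = M"
  shows "has_DMPGI M"
proof -
  obtain Y where Y: "M ** Y ** M = M" "transpose (M ** Y) = M ** Y"
    using symmetric_inner_inverse[OF M] .
  have "transpose M ** transpose X ** transpose M = transpose M"
    by (metis M matrix_mul_assoc matrix_transpose_mul)
  then obtain U where U: "transpose M ** U ** transpose M = transpose M"
      "transpose (transpose M ** U) = transpose M ** U"
    by (rule symmetric_inner_inverse)
  \<comment> \<open>Transposing back makes \<open>V ** M\<close> symmetric. \<open>Y\<close> handles
    the other side, and \<open>V ** M ** Y\<close> inherits both symmetries.\<close>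
  define V where "V = transpose U"
  have V: "M ** V ** M = M" "transpose (V ** M) = V ** M"
    unfolding V_def by (metis U matrix_mul_assoc matrix_transpose_mul transpose_transpose)+
  have *: "M ** (V ** M ** Y) = M ** Y" "(V ** M ** Y) ** M = V ** M"
    by (metis V(1) Y(1) matrix_mul_assoc)+
  then have "(V ** M ** Y) ** M ** (V ** M ** Y) = V ** M ** Y"
    by (metis matrix_mul_assoc)
  then have "is_DMPGI M (V ** M ** Y)"
    using * V Y by (simp add: is_DMPGI_def)
  then show ?thesis
    by (auto simp: has_DMPGI_def)
qed

text \<open>In the infinitesimal part of \<open>M ** X ** M\<close>, every term starts or ends with
  \<open>std_mat M\<close>.\<close>

lemma inf_mat_decomp:
  assumes "M ** X ** M = (M :: dual_num^'n^'m)"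
  obtains P Q where "inf_mat M = std_mat M ** P + Q ** std_mat M"
proof
  have "inf_mat M = inf_mat (M ** X ** M)"
    by (simp add: assms)
  also have "\<dots> = std_mat M ** (std_mat X ** inf_mat M)
      + (std_mat M ** inf_mat X + inf_mat M ** std_mat X) ** std_mat M"
    by (simp add: inf_mat_mult std_mat_mult matrix_mul_assoc)
  finally show "inf_mat M = std_mat M ** (std_mat X ** inf_mat M)
      + (std_mat M ** inf_mat X + inf_mat M ** std_mat X) ** std_mat M" .
qed

text \<open>If \<open>C K C = C\<close>, then \<open>(1 - \<epsilon> P) K (1 - \<epsilon> Q)\<close> is an inner inverse of
  \<open>C + \<epsilon> (C P + Q C) = (1 + \<epsilon> Q) C (1 + \<epsilon> P)\<close>.\<close>

lemma has_DMPGI_if_decomp: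
  fixes M :: "dual_num^'n^'m"
  assumes K: "std_mat M ** K ** std_mat M = std_mat M"
    and PQ: "inf_mat M = std_mat M ** P + Q ** std_mat M"
  shows "has_DMPGI M"
proof (rule has_DMPGI_if_inner_inverse)
  define C where "C = std_mat M"
  have C: "C ** K ** C = C" "A ** C ** K ** C = A ** C" for A :: "real^'m^'m"
    using K by (simp_all add: C_def flip: matrix_mul_assoc)
  show "M ** dual_mat K (- (P ** K + K ** Q)) ** M = M"
    unfolding dual_mat_eq_iff
    by (simp add: std_mat_mult inf_mat_mult PQ matrix_distribs matrix_mul_assoc C flip: C_def)
qed


section \<open>The sharp order\<close>

lemma sharp_le_differences:
  fixes E F G :: "real^'n^'n"
  assumes X: "E ** X ** E = E" "E ** X = X ** E"
    and Y: "F ** Y ** F = F" "F ** Y = Y ** F"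
    and Z: "G ** Z ** G = G" "G ** Z = Z ** G"
    and EF: "sharp_le E F" and FG: "sharp_le F G"
  shows "E ** G = E ** E" "G ** E = E ** E" "(G - E) ** Z ** (G - E) = G - E"
    and "F - E = (G - E) ** (F ** Y - E ** X)" "F - E = (F ** Y - E ** X) ** (G - E)"
    and "G - F = (G - E) ** (G ** Z - F ** Y)" "G - F = (G ** Z - F ** Y) ** (G - E)"
proof -
  define e f g where "e = E ** X" and "f = F ** Y" and "g = G ** Z"
  have s: "E ** F = E ** E" "F ** E = E ** E" "F ** G = F ** F" "G ** F = F ** F"
    using EF FG by (auto simp: sharp_le_def)
  have e: "e ** E = E" "E ** e = E" and f: "f ** F = F" "F ** f = F" and g: "g ** G = G" "G ** g = G"
    using X Y Z by (metis e_def f_def g_def matrix_mul_assoc)+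
  \<comment> \<open>Multiplying the order equations by \<open>X\<close> or \<open>Y\<close> cancels
    one factor.\<close>
  have eF: "e ** F = E" "F ** e = E" and fG: "f ** G = F" "G ** f = F"
    by (metis X(2) Y(2) s e f e_def f_def matrix_mul_assoc)+
  have fE: "f ** E = E" "E ** f = E"
    by (metis eF f matrix_mul_assoc)+
  have fe: "f ** e = e" "e ** f = e"
    using fE X(2) by (metis e_def matrix_mul_assoc)+
  have eG: "e ** G = E" "G ** e = E"
    by (metis fe fG eF matrix_mul_assoc)+
  have gE: "g ** E = E" "E ** g = E" and gF: "g ** F = F" "F ** g = F"
    by (metis eG fG g matrix_mul_assoc)+
  show "E ** G = E ** E" "G ** E = E ** E"
    by (metis eG e matrix_mul_assoc)+
  \<comment> \<open>\<open>g\<close> fixes \<open>E\<close> on both sides; as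
    \<open>E = e ** G\<close>, also \<open>E ** Z ** E = e ** g ** E = E\<close>.\<close>
  have "G ** Z ** E = E" "E ** Z ** G = E" "E ** Z ** E = E"
    using gE g_def Z(2) by (metis eG e matrix_mul_assoc)+
  then show "(G - E) ** Z ** (G - E) = G - E"
    by (simp add: matrix_distribs Z(1))
  show "F - E = (G - E) ** (F ** Y - E ** X)" "F - E = (F ** Y - E ** X) ** (G - E)"
    "G - F = (G - E) ** (G ** Z - F ** Y)" "G - F = (G ** Z - F ** Y) ** (G - E)"
    unfolding e_def[symmetric] f_def[symmetric] g_def[symmetric]
    by (simp_all add: matrix_distribs e f g fG eG fE gE)
qed

text \<open>From \<open>F ** E = E ** E = F ** F\<close> follows
  \<open>F = Y ** F ** E = Y ** F ** F ** E ** X = F ** E ** X = E\<close>.\<close>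

lemma sharp_le_antisym:
  fixes E F :: "real^'n^'n"
  assumes X: "E ** X ** E = E" "E ** X = X ** E" and Y: "F ** Y ** F = F" "F ** Y = Y ** F"
    and EF: "sharp_le E F" and FE: "sharp_le F E"
  shows "E = F"
proof -
  have s: "F ** E = E ** E" "F ** E = F ** F"
    using EF FE unfolding sharp_le_def by metis+
  have E: "E = E ** E ** X"
    by (metis X matrix_mul_assoc)
  have F: "F = Y ** F ** F"
    by (metis Y)
  have "F = Y ** (F ** E)"
    by (subst F) (simp add: s(2) matrix_mul_assoc)
  also have "F ** E = F ** (F ** E ** X)"
    by (subst E) (simp add: s(1))
  also have "Y ** \<dots> = (Y ** F ** F) ** E ** X"
    by (simp add: matrix_mul_assoc)
  also have "\<dots> = E"
    unfolding F[symmetric] s(1) E[symmetric] ..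
  finally show ?thesis ..
qed

text \<open>\<open>E = E ** E ** X\<close> bounds the rank of \<open>E\<close> by that of its
  square.\<close>

lemma rank_square_eq:
  assumes "E ** X ** E = E" "E ** X = X ** (E :: real^'n^'n)"
  shows "rank (E ** E) = rank E"
proof (rule antisym)
  have "E ** E ** X = E"
    by (metis assms matrix_mul_assoc)
  then show "rank E \<le> rank (E ** E)"
    by (metis rank_mul_le_left)
qed (rule rank_mul_le_left)

section \<open>The order axioms on \<open>dual_CM\<close>\<close>

lemma dual_CM_std_group_inverse:
  assumes "E \<in> dual_CM"
  obtains X where "std_mat E ** X ** std_mat E = std_mat E" "std_mat E ** X = X ** std_mat E"
proof -
  obtain X where X: "E ** X ** E = E" "E ** X = X ** E"
    using assms by (auto simp: dual_CM_def is_DGGI_def)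
  then have "std_mat (E ** X ** E) = std_mat E" "std_mat (E ** X) = std_mat (X ** E)"
    by simp_all
  then show thesis
    unfolding std_mat_mult by (rule that)
qed

theorem theorem4p2:
  shows "partial_order_on (dual_CM :: (dual_num^'n^'n) set) DM_sharp_order"
proof -
  have refl: "DM_sharp_le E E" if "E \<in> dual_CM" for E :: "dual_num^'n^'n"
  proof -
    obtain X where "std_mat E ** X ** std_mat E = std_mat E" "std_mat E ** X = X ** std_mat E"
      using dual_CM_std_group_inverse[OF \<open>E \<in> dual_CM\<close>] .
    then have "sharp_le (std_mat E) (std_mat E)"
      unfolding sharp_le_def using rank_square_eq by blast
    moreover have "has_DMPGI (E - E)"
      by (rule has_DMPGI_if_inner_inverse[of _ 0]) (simp add: matrix_matrix_mult_def vec_eq_iff)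
    ultimately show ?thesis
      by (simp add: DM_sharp_le_def)
  qed
  have antisym: "E = F" if "E \<in> dual_CM" "F \<in> dual_CM" and DM: "DM_sharp_le E F" "DM_sharp_le F E"
    for E F :: "dual_num^'n^'n"
  proof -
    have std: "std_mat E = std_mat F"
      using that by (auto simp: DM_sharp_le_def intro: sharp_le_antisym elim!: dual_CM_std_group_inverse)
    obtain M where "(F - E) ** M ** (F - E) = F - E"
      using DM by (auto simp: DM_sharp_le_def has_DMPGI_def is_DMPGI_def)
    then obtain P Q where "inf_mat (F - E) = std_mat (F - E) ** P + Q ** std_mat (F - E)"
      by (rule inf_mat_decomp)
    then have "inf_mat E = inf_mat F"
      by (simp add: inf_mat_simps std_mat_simps std matrix_matrix_mult_def vec_eq_iff)
    with std show ?thesis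
      by (simp add: dual_mat_eq_iff)
  qed
  have trans: "DM_sharp_le E G"
    if "E \<in> dual_CM" "F \<in> dual_CM" "G \<in> dual_CM" and DM: "DM_sharp_le E F" "DM_sharp_le F G"
    for E F G :: "dual_num^'n^'n"
  proof -
    obtain X where X: "std_mat E ** X ** std_mat E = std_mat E" "std_mat E ** X = X ** std_mat E"
      using dual_CM_std_group_inverse[OF \<open>E \<in> dual_CM\<close>] .
    obtain Y where Y: "std_mat F ** Y ** std_mat F = std_mat F" "std_mat F ** Y = Y ** std_mat F"
      using dual_CM_std_group_inverse[OF \<open>F \<in> dual_CM\<close>] .
    obtain Z where Z: "std_mat G ** Z ** std_mat G = std_mat G" "std_mat G ** Z = Z ** std_mat G"
      using dual_CM_std_group_inverse[OF \<open>G \<in> dual_CM\<close>] .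
    have le: "sharp_le (std_mat E) (std_mat F)" "sharp_le (std_mat F) (std_mat G)"
      using DM by (auto simp: DM_sharp_le_def)
    note diffs = sharp_le_differences[OF X Y Z le]
    define C where "C = std_mat G - std_mat E"
    \<comment> \<open>The same \<open>a\<close> works on both sides of \<open>C\<close>, so
      \<open>C\<close> can stand outermost both in the term with \<open>P\<close> and in the term
      with \<open>Q\<close>.\<close>
    obtain a where a: "std_mat F - std_mat E = C ** a" "std_mat F - std_mat E = a ** C"
      using diffs(4,5) C_def by blast
    obtain b where b: "std_mat G - std_mat F = C ** b" "std_mat G - std_mat F = b ** C"
      using diffs(6,7) C_def by blast
    obtain M N where "(F - E) ** M ** (F - E) = F - E" "(G - F) ** N ** (G - F) = G - F"
      using DM by (auto simp: DM_sharp_le_def has_DMPGI_def is_DMPGI_def)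
    then obtain P Q R S where
      PQ: "inf_mat (F - E) = std_mat (F - E) ** P + Q ** std_mat (F - E)" and
      RS: "inf_mat (G - F) = std_mat (G - F) ** R + S ** std_mat (G - F)"
      by (metis inf_mat_decomp)
    have "inf_mat (G - E) = inf_mat (F - E) + inf_mat (G - F)"
      by (simp add: inf_mat_simps)
    also have "\<dots> = (C ** a ** P + Q ** (a ** C)) + (C ** b ** R + S ** (b ** C))"
      unfolding PQ RS std_mat_simps by (metis a b)
    also have "\<dots> = C ** (a ** P + b ** R) + (Q ** a + S ** b) ** C"
      by (simp add: matrix_distribs matrix_mul_assoc)
    finally have "has_DMPGI (G - E)"
      by (intro has_DMPGI_if_decomp[where K = Z]) (simp_all add: std_mat_simps diffs(3) C_def)
    moreover have "sharp_le (std_mat E) (std_mat G)"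
      using le diffs(1,2) unfolding sharp_le_def by metis
    ultimately show ?thesis
      by (simp add: DM_sharp_le_def)
  qed
  show ?thesis
    unfolding partial_order_on_def preorder_on_def refl_on_def trans_def antisym_def DM_sharp_order_def
    using refl antisym trans by blast
qed

end
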